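(* Let $T:\mathbb{R}^d\to\mathbb{R}^d$ be a nonexpansive operator with respect to a norm $\|\cdot\|$, let $v$ be the minimum-norm element (with respect to $\|\cdot\|$) of $\mathrm{cl}(\mathrm{range}(T-I))$, let $z^0\in\mathbb{R}^d$, let $z^{k+1}=T(z^k)$ for $k\ge 0$, and let $\bar z^k=\frac1k\sum_{j=1}^k z^j$ for $k\ge 1$. Then for any $\varepsilon>0$ there exists $z_\varepsilon\in\mathbb{R}^d$ such that for all $k\ge 1$ the following two inequalities hold: (1) $\left\|v-\frac{2}{k+1}\left(\bar z^k-z^0\right)\right\|\le \frac{4}{k+1}\|z^0-z_\varepsilon\|+\varepsilon$; (2) $\left\|v-\frac1k\left(z^k-z^0\right)\right\|\le \frac{2}{k}\|z^0-z_\varepsilon\|+\varepsilon$. Furthermore, if $\mathrm{range}(T-I)$ is closed, then there exists $z^\star\in\mathbb{R}^d$ such that $T(z^\star)=z^\star+v$, and for any such $z^\star$ and all $k\ge 1$: (3) $\left\|v-\frac{2}{k+1}\left(\bar z^k-z^0\right)\right\|\le \frac{4}{k+1}\|z^0-z^\star\|$; (4) $\left\|v-\frac1k\left(z^k-z^0\right)\right\|\le \frac{2}{k}\|z^0-z^\star\|$.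
   Context: The norm $\|\cdot\|$ is of the form $\|x\|=\sqrt{x^\top M x}$ for a symmetric positive definite matrix $M\in\mathbb{R}^{d\times d}$. $T$ is nonexpansive with respect to $\|\cdot\|$ if $\|T(z_1)-T(z_2)\|\le\|z_1-z_2\|$ for all $z_1,z_2\in\mathbb{R}^d$. $I$ is the identity map, $\mathrm{range}(T-I)=\{T(z)-z: z\in\mathbb{R}^d\}$, and $\mathrm{cl}$ denotes closure. For nonexpansive $T$ the set $\mathrm{cl}(\mathrm{range}(T-I))$ is convex (Pazy), so its minimum-norm element $v$ exists and is unique; it is called the infimal displacement vector of $T$. *)

theory Defs
  imports "HOL-Analysis.Analysis"
begin

definition sym_pos_def :: "real ^ 'n ^ 'n \<Rightarrow> bool" where
  "sym_pos_def M \<longleftrightarrow> transpose M = M \<and> (\<forall>x. x \<noteq> 0 \<longrightarrow> x \<bullet> (M *v x) > 0)"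

definition mat_norm :: "real ^ 'n ^ 'n \<Rightarrow> real ^ 'n \<Rightarrow> real" where
  "mat_norm M x = sqrt (x \<bullet> (M *v x))"

definition nonexpansive_wrt :: "('a::real_vector \<Rightarrow> real) \<Rightarrow> ('a \<Rightarrow> 'a) \<Rightarrow> bool" where
  "nonexpansive_wrt N T \<longleftrightarrow> (\<forall>x y. N (T x - T y) \<le> N (x - y))"

definition displacement_range :: "('a::real_vector \<Rightarrow> 'a) \<Rightarrow> 'a set" where
  "displacement_range T = range (\<lambda>z. T z - z)"

text \<open>
  The closure is taken in the standard topology of the Euclidean space, which is also the
  topology induced by \<open>mat_norm M\<close> when \<open>M\<close> is symmetric positive definite.  Existence and
  uniqueness of a minimiser are not part of the predicate: it only says that \<open>v\<close> is an element
  of the closure of least norm.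
\<close>

definition infimal_displacement_vector ::
    "(real ^ 'n \<Rightarrow> real) \<Rightarrow> (real ^ 'n \<Rightarrow> real ^ 'n) \<Rightarrow> real ^ 'n \<Rightarrow> bool" where
  "infimal_displacement_vector N T v \<longleftrightarrow>
     is_arg_min N (\<lambda>x. x \<in> closure (displacement_range T)) v"

text \<open>The average omits the starting point \<open>z 0\<close>.\<close>

definition avg_iterate :: "(nat \<Rightarrow> 'a::real_vector) \<Rightarrow> nat \<Rightarrow> 'a" where
  "avg_iterate z k = (1 / real k) *\<^sub>R (\<Sum>j = 1..k. z j)"

end

theory Submission
  imports Defs
begin

text \<open>
  By Brouwer, for every \<open>t > 0\<close> there is \<open>y\<close> with \<open>T y = (1 + t) y\<close>.  Nonexpansiveness at \<open>y\<close> and an arbitrary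
  \<open>x\<close> shows that \<open>w = t y\<close>, which lies in \<open>range (T - I)\<close>, satisfies
  \<open>\<langle>w - t x, w - (T x - x)\<rangle> \<le> 0\<close>.  A cluster point of \<open>w\<close> as \<open>t \<rightarrow> 0\<close> therefore obeys the variational
  inequality characterising \<open>v\<close>, so that \<open>\<langle>T x - x, v\<rangle> \<ge> \<parallel>v\<parallel>\<^sup>2\<close> for all \<open>x\<close>, without an appeal to
  the convexity of the closure of the range.

  Displacements have nonincreasing norm along an orbit.  If the first one has squared norm at most
  \<open>\<parallel>v\<parallel>\<^sup>2 + \<epsilon>\<^sup>2\<close>, the variational inequality puts all of them within \<open>\<epsilon>\<close> of \<open>v\<close>, so this orbit
  stays within \<open>k \<epsilon>\<close> of \<open>z + k v\<close>; any other orbit stays at bounded distance from it.  The case of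
  closed range is \<open>\<epsilon> = 0\<close>.
\<close>

section \<open>The inner product and norm induced by \<open>M\<close>\<close>

locale spd_matrix =
  fixes M :: "real ^ 'n ^ 'n"
  assumes spd: "sym_pos_def M"
begin

abbreviation ip :: "real ^ 'n \<Rightarrow> real ^ 'n \<Rightarrow> real" where
  "ip x y \<equiv> x \<bullet> (M *v y)"

abbreviation N :: "real ^ 'n \<Rightarrow> real" where
  "N \<equiv> mat_norm M"

sublocale ip: bounded_bilinear ip
  using bounded_bilinear.comp[OF bounded_bilinear_inner bounded_linear_ident
      matrix_vector_mul_bounded_linear[of M]] by simp

lemma ip_commute: "ip x y = ip y x"
proof -
  have "ip x y = (transpose M *v x) \<bullet> y"
    by (simp only: transpose_matrix_vector dot_lmul_matrix)
  then show ?thesis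
    using spd unfolding sym_pos_def_def by (metis inner_commute)
qed

lemma ip_pos: "x \<noteq> 0 \<Longrightarrow> 0 < ip x x"
  using spd by (simp add: sym_pos_def_def)

lemma ip_nonneg: "0 \<le> ip x x"
  using ip_pos[of x] by (cases "x = 0") auto

lemma N_power2: "(N x)\<^sup>2 = ip x x"
  by (simp add: mat_norm_def ip_nonneg)

lemma N_nonneg: "0 \<le> N x"
  by (simp add: mat_norm_def ip_nonneg)

lemma N_pos: "x \<noteq> 0 \<Longrightarrow> 0 < N x"
  by (simp add: mat_norm_def ip_pos)

lemma N_zero [simp]: "N 0 = 0"
  by (simp add: mat_norm_def)

lemma N_scaleR: "N (a *\<^sub>R x) = \<bar>a\<bar> * N x"
  by (simp add: mat_norm_def ip.scaleR_left ip.scaleR_right real_sqrt_mult flip: mult.assoc)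

lemma N_minus: "N (- x) = N x"
  using N_scaleR[of "-1" x] by simp

lemma N_minus_commute: "N (x - y) = N (y - x)"
  using N_minus[of "x - y"] by simp

lemma N_diff_power2: "(N (x - y))\<^sup>2 = (N x)\<^sup>2 - 2 * ip x y + (N y)\<^sup>2"
  by (simp add: N_power2 ip.diff_left ip.diff_right ip_commute[of y x])

text \<open>Cauchy-Schwarz: for nonzero vectors, expanding the square of
  \<open>N (N y *\<^sub>R x - N x *\<^sub>R y)\<close> leaves a positive multiple of
  \<open>N x * N y - ip x y\<close>.\<close>

lemma ip_le: "ip x y \<le> N x * N y"
proof (cases "x = 0 \<or> y = 0")
  case False
  then have pos: "0 < N x * N y"
    by (simp add: N_pos)
  have "0 \<le> (N (N y *\<^sub>R x - N x *\<^sub>R y))\<^sup>2"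
    by simp
  also have "\<dots> = 2 * (N x * N y) * (N x * N y - ip x y)"
    unfolding N_diff_power2
    by (simp add: N_scaleR N_nonneg ip.scaleR_left ip.scaleR_right power2_eq_square algebra_simps)
  finally show ?thesis
    using pos by (simp add: zero_le_mult_iff)
qed (auto simp: ip.zero_left ip.zero_right)

lemma N_triangle: "N (x + y) \<le> N x + N y"
proof (rule power2_le_imp_le)
  have "(N (x + y))\<^sup>2 = (N x)\<^sup>2 + 2 * ip x y + (N y)\<^sup>2"
    by (simp add: N_power2 ip.add_left ip.add_right ip_commute[of y x])
  also have "\<dots> \<le> (N x + N y)\<^sup>2"
    using ip_le[of x y] by (simp add: power2_sum)
  finally show "(N (x + y))\<^sup>2 \<le> (N x + N y)\<^sup>2" .
qed (simp add: N_nonneg)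

lemma N_sum: "N (sum f A) \<le> (\<Sum>i\<in>A. N (f i))"
proof (induction A rule: infinite_finite_induct)
  case (insert a A)
  then show ?case
    using N_triangle[of "f a" "sum f A"] by simp
qed auto

lemma continuous_on_N: "continuous_on S N"
  unfolding mat_norm_def by (intro continuous_intros matrix_vector_mult_linear_continuous_on)

text \<open>The constant is the minimum of \<open>N\<close> over the compact Euclidean unit sphere;
  homogeneity extends the bound. Together with the upper bound in \<open>N_le_norm\<close> it lets
  topological facts pass between \<open>N\<close> and the Euclidean norm.\<close>

lemma N_coercive: "\<exists>c>0. \<forall>x. c * norm x \<le> N x"
proof -
  have "sphere (0 :: real ^ 'n) 1 \<noteq> {}"
    by simp
  then obtain u where u: "u \<in> sphere 0 1" "\<forall>x \<in> sphere 0 1. N u \<le> N x"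
    using continuous_attains_inf[OF compact_sphere _ continuous_on_N] by meson
  have "N u * norm x \<le> N x" for x
  proof (cases "x = 0")
    case False
    then have "N u \<le> N ((1 / norm x) *\<^sub>R x)"
      using u(2) by simp
    then show ?thesis
      using False by (simp add: N_scaleR field_simps)
  qed simp
  moreover have "0 < N u"
    using u(1) by (intro N_pos) auto
  ultimately show ?thesis
    by blast
qed

lemma N_le_norm: "\<exists>C>0. \<forall>x. N x \<le> C * norm x"
proof -
  obtain C where C: "0 < C" "\<And>x y. norm (ip x y) \<le> norm x * norm y * C"
    using ip.pos_bounded by blast
  have "N x \<le> sqrt C * norm x" for x
  proof (rule power2_le_imp_le)
    have "(N x)\<^sup>2 \<le> norm x * norm x * C"
      unfolding N_power2 using order_trans[OF abs_ge_self C(2)[of x x, unfolded real_norm_def]] .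
    also have "\<dots> = (sqrt C)\<^sup>2 * (norm x)\<^sup>2"
      using C(1) by (simp add: power2_eq_square)
    finally show "(N x)\<^sup>2 \<le> (sqrt C * norm x)\<^sup>2"
      by (simp only: power_mult_distrib)
  qed (use C(1) in simp)
  moreover have "0 < sqrt C"
    using C(1) by simp
  ultimately show ?thesis
    by blast
qed

text \<open>Serves twice: as the domain for Brouwer and for extracting a cluster point.\<close>

lemma compact_N_ball: "compact {x. N x \<le> R}"
proof -
  obtain c where c: "0 < c" "\<And>x. c * norm x \<le> N x"
    using N_coercive by blast
  have "norm x \<le> R / c" if "N x \<le> R" for x
    using c(1) order_trans[OF c(2) that] by (simp add: field_simps)
  then have "bounded {x. N x \<le> R}"
    by (auto intro: boundedI)
  moreover have "closed {x. N x \<le> R}"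
    using continuous_on_N[of UNIV] by (intro closed_Collect_le) auto
  ultimately show ?thesis
    by (simp add: compact_eq_bounded_closed)
qed

lemma convex_N_ball: "convex {x. N x \<le> R}"
proof (rule convexI)
  fix x y :: "real ^ 'n" and a b :: real
  assume xy: "x \<in> {x. N x \<le> R}" "y \<in> {x. N x \<le> R}" and ab: "0 \<le> a" "0 \<le> b" "a + b = 1"
  have "N (a *\<^sub>R x + b *\<^sub>R y) \<le> a * N x + b * N y"
    using N_triangle[of "a *\<^sub>R x" "b *\<^sub>R y"] ab by (simp add: N_scaleR)
  also have "\<dots> \<le> R"
    using xy ab by (intro convex_bound_le) auto
  finally show "a *\<^sub>R x + b *\<^sub>R y \<in> {x. N x \<le> R}"
    by simp
qed

end

section \<open>Nonexpansive maps and the variational inequality on the range\<close>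

locale nonexpansive_map = spd_matrix M for M :: "real ^ 'n ^ 'n" +
  fixes T :: "real ^ 'n \<Rightarrow> real ^ 'n"
  assumes nonexpansive: "nonexpansive_wrt (mat_norm M) T"
begin

lemma N_T_diff: "N (T x - T y) \<le> N (x - y)"
  using nonexpansive by (simp add: nonexpansive_wrt_def)

lemma continuous_on_T: "continuous_on S T"
proof -
  obtain c where c: "0 < c" "\<And>x. c * norm x \<le> N x"
    using N_coercive by blast
  obtain C where C: "0 < C" "\<And>x. N x \<le> C * norm x"
    using N_le_norm by blast
  have "(C / c)-lipschitz_on S T"
  proof (rule lipschitz_onI)
    fix x y
    have "c * norm (T x - T y) \<le> C * norm (x - y)"
      using c(2)[of "T x - T y"] N_T_diff[of x y] C(2)[of "x - y"] by linarith
    then show "dist (T x) (T y) \<le> C / c * dist x y"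
      using c(1) by (simp add: dist_norm field_simps)
  qed (use c C in simp)
  then show ?thesis
    by (rule lipschitz_on_continuous_on)
qed

text \<open>Brouwer applied to \<open>T\<close> divided by \<open>1 + t\<close> on a large enough
  \<open>N\<close>-ball.\<close>

lemma scaled_fixed_point:
  assumes "0 < t"
  shows "\<exists>y. T y = (1 + t) *\<^sub>R y"
proof -
  \<comment> \<open>This radius makes the ball invariant:
    \<open>N (T y) \<le> N y + N (T 0) \<le> R + t * R\<close>.\<close>
  define R where "R = N (T 0) / t"
  define f where "f = (\<lambda>y. (1 / (1 + t)) *\<^sub>R T y)"
  have R: "N (T 0) = t * R" "0 \<le> R"
    using assms by (simp_all add: R_def N_nonneg)
  have "f \<in> {x. N x \<le> R} \<rightarrow> {x. N x \<le> R}"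
  proof
    fix y assume "y \<in> {x. N x \<le> R}"
    then have "N (T y) \<le> (1 + t) * R"
      using N_triangle[of "T y - T 0" "T 0"] N_T_diff[of y 0] R(1) by (simp add: algebra_simps)
    then show "f y \<in> {x. N x \<le> R}"
      using assms by (simp add: f_def N_scaleR field_simps)
  qed
  moreover have "continuous_on {x. N x \<le> R} f"
    unfolding f_def by (intro continuous_intros continuous_on_T)
  moreover have "{x. N x \<le> R} \<noteq> {}"
    using R(2) by (auto intro!: exI[of _ 0])
  ultimately obtain y where "f y = y"
    using brouwer[OF compact_N_ball convex_N_ball] by metis
  then have "(1 + t) *\<^sub>R y = (1 + t) *\<^sub>R f y"
    by simp
  also have "\<dots> = T y"
    using assms by (simp add: f_def)
  finally show ?thesis
    by metis
qed

lemma approximate_variational_inequality: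
  assumes "0 < t"
  shows "\<exists>w \<in> displacement_range T. \<forall>x. ip (w - t *\<^sub>R x) (w - (T x - x)) \<le> 0"
proof -
  obtain y where y: "T y = (1 + t) *\<^sub>R y"
    using scaled_fixed_point[OF assms] by blast
  define w where "w = t *\<^sub>R y"
  have Ty: "T y - y = w"
    using y by (simp add: w_def algebra_simps)
  have "ip (w - t *\<^sub>R x) (w - (T x - x)) \<le> 0" for x
  proof -
    let ?a = "y - x" and ?b = "w - (T x - x)"
    \<comment> \<open>Written as a difference so that \<open>N_diff_power2\<close> expands it;
      cancelling the square of \<open>N ?a\<close> leaves a bound on
      \<open>ip ?a ?b\<close>.\<close>
    have "T y - T x = ?a - (- ?b)"
      using Ty by (simp add: algebra_simps)
    then have "(N (?a - (- ?b)))\<^sup>2 \<le> (N ?a)\<^sup>2"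
      using N_T_diff[of y x] by (metis N_nonneg power_mono)
    then have "2 * ip ?a ?b + (N ?b)\<^sup>2 \<le> 0"
      unfolding N_diff_power2 N_minus ip.minus_right by simp
    then have "ip ?a ?b \<le> 0"
      using zero_le_power2[of "N ?b"] by linarith
    then have "t * ip ?a ?b \<le> 0"
      using assms by (simp add: mult_le_0_iff)
    moreover have "w - t *\<^sub>R x = t *\<^sub>R ?a"
      by (simp add: w_def algebra_simps)
    ultimately show ?thesis
      by (simp only: ip.scaleR_left real_scaleR_def)
  qed
  moreover have "w \<in> displacement_range T"
    unfolding displacement_range_def using Ty by blast
  ultimately show ?thesis
    by blast
qed

lemma variational_solution_exists:
  "\<exists>w \<in> closure (displacement_range T). \<forall>u \<in> closure (displacement_range T). ip w w \<le> ip w u"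
proof -
  define t where "t n = 1 / real (Suc n)" for n
  have t: "0 < t n" for n
    by (simp add: t_def)
  have "\<forall>n. \<exists>w \<in> displacement_range T. \<forall>x. ip (w - t n *\<^sub>R x) (w - (T x - x)) \<le> 0"
    using approximate_variational_inequality t by blast
  then obtain w where w: "\<And>n. w n \<in> displacement_range T"
    and ineq: "\<And>n x. ip (w n - t n *\<^sub>R x) (w n - (T x - x)) \<le> 0"
    by metis
  \<comment> \<open>Taking \<open>x = 0\<close> removes \<open>t n\<close> from the inequality, so
    the bound is uniform in \<open>n\<close>.\<close>
  have "N (w n) \<le> N (T 0)" for n
  proof -
    have "N (w n) * N (w n) \<le> N (w n) * N (T 0)"
      using ineq[of n 0] ip_le[of "w n" "T 0"] N_power2[of "w n"]
      by (simp add: ip.diff_right power2_eq_square)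
    then show ?thesis
      using N_nonneg[of "w n"] N_nonneg[of "T 0"] by (cases "N (w n) = 0") auto
  qed
  then obtain l r where l: "strict_mono r" "(w \<circ> r) \<longlonglongrightarrow> l"
    using compact_N_ball[of "N (T 0)"] unfolding compact_def by blast
  have t_lim: "(t \<circ> r) \<longlonglongrightarrow> 0"
    using LIMSEQ_subseq_LIMSEQ[OF _ l(1), of t 0] lim_1_over_n[THEN LIMSEQ_Suc] unfolding t_def
    by blast
  \<comment> \<open>The term \<open>t n *\<^sub>R x\<close> vanishes in the limit because
    \<open>x\<close> is fixed. What remains places the range in a closed half-space, which then
    contains its closure.\<close>
  have "ip (l - 0 *\<^sub>R x) (l - (T x - x)) \<le> 0" for x
  proof (rule LIMSEQ_le_const2)
    show "(\<lambda>n. ip ((w \<circ> r) n - (t \<circ> r) n *\<^sub>R x) ((w \<circ> r) n - (T x - x)))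
            \<longlonglongrightarrow> ip (l - 0 *\<^sub>R x) (l - (T x - x))"
      by (intro ip.tendsto tendsto_intros l t_lim)
    show "\<exists>n0. \<forall>n\<ge>n0. ip ((w \<circ> r) n - (t \<circ> r) n *\<^sub>R x) ((w \<circ> r) n - (T x - x)) \<le> 0"
      using ineq by auto
  qed
  then have "displacement_range T \<subseteq> {u. ip l l \<le> ip l u}"
    by (auto simp: displacement_range_def ip.diff_right)
  moreover have "closed {u. ip l l \<le> ip l u}"
    by (intro closed_Collect_le continuous_intros matrix_vector_mult_linear_continuous_on)
  ultimately have "closure (displacement_range T) \<subseteq> {u. ip l l \<le> ip l u}"
    by (rule closure_minimal)
  moreover have "l \<in> closure (displacement_range T)"
    unfolding closure_sequential using w l(2) by (intro exI[of _ "w \<circ> r"]) simp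
  ultimately show ?thesis
    by blast
qed

end

section \<open>Orbits and the infimal displacement vector\<close>

locale infimal_displacement = nonexpansive_map M T
  for M :: "real ^ 'n ^ 'n" and T :: "real ^ 'n \<Rightarrow> real ^ 'n" +
  fixes v :: "real ^ 'n"
  assumes infimal: "infimal_displacement_vector (mat_norm M) T v"
begin

lemma v_in_closure: "v \<in> closure (displacement_range T)"
  using infimal by (simp add: infimal_displacement_vector_def is_arg_min_def)

lemma v_minimal: "u \<in> closure (displacement_range T) \<Longrightarrow> N v \<le> N u"
  using infimal by (auto simp: infimal_displacement_vector_def is_arg_min_linorder)

text \<open>The solution \<open>w\<close> found above equals \<open>v\<close>: its inequality at
  \<open>v\<close> bounds the square of \<open>N (w - v)\<close> by that of \<open>N v\<close> minus
  that of \<open>N w\<close>, and minimality of \<open>v\<close> makes this nonpositive.\<close>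

lemma variational_inequality: "(N v)\<^sup>2 \<le> ip v (T x - x)"
proof -
  obtain w where w: "w \<in> closure (displacement_range T)"
    "\<And>u. u \<in> closure (displacement_range T) \<Longrightarrow> ip w w \<le> ip w u"
    using variational_solution_exists by blast
  have "(N v)\<^sup>2 \<le> (N w)\<^sup>2"
    using v_minimal[OF w(1)] N_nonneg power_mono by blast
  then have "(N (w - v))\<^sup>2 \<le> 0"
    using w(2)[OF v_in_closure] N_diff_power2[of w v] N_power2[of w] by linarith
  then have "w = v"
    using N_pos[of "w - v"] by auto
  moreover have "T x - x \<in> closure (displacement_range T)"
    by (rule subsetD[OF closure_subset]) (simp add: displacement_range_def)
  ultimately show ?thesis
    using w(2) unfolding N_power2 by blast
qed

text \<open>By the variational inequality, the cross term in the expanded square is at most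
  \<open>- 2 * (N v)\<^sup>2\<close>.\<close>

lemma displacement_near_v:
  assumes "(N (T x - x))\<^sup>2 \<le> (N v)\<^sup>2 + \<epsilon>\<^sup>2" "0 \<le> \<epsilon>"
  shows "N (T x - x - v) \<le> \<epsilon>"
proof (rule power2_le_imp_le)
  show "(N (T x - x - v))\<^sup>2 \<le> \<epsilon>\<^sup>2"
    using variational_inequality[of x] assms(1) N_diff_power2[of "T x - x" v]
      ip_commute[of "T x - x" v] by linarith
qed fact

lemma orbit_near_line:
  assumes "(N (T x - x))\<^sup>2 \<le> (N v)\<^sup>2 + \<epsilon>\<^sup>2" "0 \<le> \<epsilon>"
  shows "N ((T ^^ k) x - x - real k *\<^sub>R v) \<le> real k * \<epsilon>"
proof (induction k)
  case (Suc k)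
  let ?y = "(T ^^ k) x"
  \<comment> \<open>Each displacement is the difference of the \<open>T\<close>-images of two
    consecutive points, hence no longer than the previous one.\<close>
  have "N (T ((T ^^ j) x) - (T ^^ j) x) \<le> N (T x - x)" for j
    by (induction j) (auto intro: order_trans[OF N_T_diff])
  then have "(N (T ?y - ?y))\<^sup>2 \<le> (N v)\<^sup>2 + \<epsilon>\<^sup>2"
    using assms(1) N_nonneg power_mono order_trans by meson
  then have "N (T ?y - ?y - v) \<le> \<epsilon>"
    using assms(2) by (rule displacement_near_v)
  moreover have "(T ^^ Suc k) x - x - real (Suc k) *\<^sub>R v
      = (?y - x - real k *\<^sub>R v) + (T ?y - ?y - v)"
    by (simp add: algebra_simps)
  ultimately show ?case
    using Suc N_triangle[of "?y - x - real k *\<^sub>R v" "T ?y - ?y - v"]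
    by (simp add: algebra_simps)
qed simp

text \<open>The distance \<open>N (z 0 - x)\<close> is paid twice: between the starting points and
  between the two orbits at time \<open>k\<close>.\<close>

lemma iterate_near_line:
  assumes z: "\<And>k. z (Suc k) = T (z k)"
    and x: "(N (T x - x))\<^sup>2 \<le> (N v)\<^sup>2 + \<epsilon>\<^sup>2" "0 \<le> \<epsilon>"
  shows "N (real k *\<^sub>R v - (z k - z 0)) \<le> 2 * N (z 0 - x) + real k * \<epsilon>"
proof -
  let ?y = "(T ^^ k) x"
  have "N ((T ^^ j) x - z j) \<le> N (z 0 - x)" for j
    by (induction j) (auto simp: z N_minus_commute[of x] intro: order_trans[OF N_T_diff])
  moreover have "real k *\<^sub>R v - (z k - z 0) = (?y - z k) + (z 0 - x) + - (?y - x - real k *\<^sub>R v)"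
    by (simp add: algebra_simps)
  ultimately show ?thesis
    using N_triangle[of "(?y - z k) + (z 0 - x)" "- (?y - x - real k *\<^sub>R v)"]
      N_triangle[of "?y - z k" "z 0 - x"] orbit_near_line[OF x, of k]
    unfolding N_minus by (smt (verit))
qed

lemma normalized_iterate_bound:
  assumes z: "\<And>k. z (Suc k) = T (z k)"
    and x: "(N (T x - x))\<^sup>2 \<le> (N v)\<^sup>2 + \<epsilon>\<^sup>2" "0 \<le> \<epsilon>"
    and k: "1 \<le> k"
  shows "N (v - (1 / real k) *\<^sub>R (z k - z 0)) \<le> 2 / real k * N (z 0 - x) + \<epsilon>"
proof -
  have "v - (1 / real k) *\<^sub>R (z k - z 0) = (1 / real k) *\<^sub>R (real k *\<^sub>R v - (z k - z 0))"
    using k by (simp add: algebra_simps)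
  then have "N (v - (1 / real k) *\<^sub>R (z k - z 0)) = N (real k *\<^sub>R v - (z k - z 0)) / real k"
    by (simp only: N_scaleR) simp
  also have "\<dots> \<le> (2 * N (z 0 - x) + real k * \<epsilon>) / real k"
    by (intro divide_right_mono iterate_near_line[where z = z, OF z x]) simp
  also have "\<dots> = 2 / real k * N (z 0 - x) + \<epsilon>"
    using k by (simp add: add_divide_distrib)
  finally show ?thesis .
qed

text \<open>The averaged error is a weighted sum of the errors of the iterates, so the bound for
  single iterates is summed over \<open>j\<close>.\<close>

lemma normalized_average_bound:
  assumes z: "\<And>k. z (Suc k) = T (z k)"
    and x: "(N (T x - x))\<^sup>2 \<le> (N v)\<^sup>2 + \<epsilon>\<^sup>2" "0 \<le> \<epsilon>"
    and k: "1 \<le> k"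
  shows "N (v - (2 / (real k + 1)) *\<^sub>R (avg_iterate z k - z 0))
    \<le> 4 / (real k + 1) * N (z 0 - x) + \<epsilon>"
proof -
  let ?s = "\<lambda>j. real j *\<^sub>R v - (z j - z 0)"
  \<comment> \<open>The reciprocal of \<open>1 + ... + k\<close>, which normalises the coefficient
    of \<open>v\<close> to 1.\<close>
  define c where "c = 2 / (real k * (real k + 1))"
  have gauss: "(\<Sum>j = 1..k. real j) = real k * (real k + 1) / 2"
    by (induction k) (auto simp: field_simps)
  have c: "0 \<le> c" "c * (real k * (real k + 1) / 2) = 1" "c * real k = 2 / (real k + 1)"
    "c = 2 / (real k + 1) * (1 / real k)"
    using k by (simp_all add: c_def)
  have "(\<Sum>j = 1..k. ?s j)
      = (real k * (real k + 1) / 2) *\<^sub>R v - ((\<Sum>j = 1..k. z j) - real k *\<^sub>R z 0)"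
    unfolding gauss[symmetric]
    by (simp add: sum_subtractf sum_constant_scaleR scaleR_left.sum del: sum_constant)
  then have "c *\<^sub>R (\<Sum>j = 1..k. ?s j)
      = (c * (real k * (real k + 1) / 2)) *\<^sub>R v
        - (c *\<^sub>R (\<Sum>j = 1..k. z j) - (c * real k) *\<^sub>R z 0)"
    by (simp add: scaleR_diff_right)
  also have "\<dots> = v - (2 / (real k + 1)) *\<^sub>R (avg_iterate z k - z 0)"
    unfolding c(2,3) by (simp add: c(4) avg_iterate_def scaleR_diff_right)
  finally have "N (v - (2 / (real k + 1)) *\<^sub>R (avg_iterate z k - z 0))
      = N (c *\<^sub>R (\<Sum>j = 1..k. ?s j))"
    by (rule arg_cong[OF sym])
  also have "\<dots> = c * N (\<Sum>j = 1..k. ?s j)"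
    using c(1) by (simp only: N_scaleR abs_of_nonneg)
  also have "\<dots> \<le> c * (\<Sum>j = 1..k. 2 * N (z 0 - x) + real j * \<epsilon>)"
    by (intro mult_left_mono order_trans[OF N_sum] sum_mono iterate_near_line[where z = z, OF z x] c(1))
  also have "\<dots> = 2 * (c * real k) * N (z 0 - x) + (c * (real k * (real k + 1) / 2)) * \<epsilon>"
    unfolding sum.distrib sum_distrib_right[symmetric] gauss by (simp add: algebra_simps)
  also have "\<dots> = 4 / (real k + 1) * N (z 0 - x) + \<epsilon>"
    unfolding c(2,3) by simp
  finally show ?thesis .
qed

text \<open>Continuity of \<open>N\<close> along a sequence of displacements converging to
  \<open>v\<close>.\<close>

lemma exists_near_minimal_displacement:
  assumes "0 < \<epsilon>"
  shows "\<exists>x. (N (T x - x))\<^sup>2 \<le> (N v)\<^sup>2 + \<epsilon>\<^sup>2"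
proof -
  obtain u where u: "\<And>n. u n \<in> displacement_range T" "u \<longlonglongrightarrow> v"
    using v_in_closure unfolding closure_sequential by blast
  have "(\<lambda>n. (N (u n))\<^sup>2) \<longlonglongrightarrow> (N v)\<^sup>2"
    using continuous_on_tendsto_compose[OF continuous_on_N[of UNIV] u(2)]
    by (intro tendsto_power) auto
  then have "\<forall>\<^sub>F n in sequentially. (N (u n))\<^sup>2 < (N v)\<^sup>2 + \<epsilon>\<^sup>2"
    using assms by (intro order_tendstoD(2)) auto
  then obtain n where "(N (u n))\<^sup>2 < (N v)\<^sup>2 + \<epsilon>\<^sup>2"
    by (auto simp: eventually_sequentially)
  moreover obtain x where "u n = T x - x"
    using u(1)[of n] by (auto simp: displacement_range_def)
  ultimately show ?thesis
    by (intro exI[of _ x]) simp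
qed

end

theorem theorem3:
  fixes M :: "real ^ 'n ^ 'n"
    and T :: "real ^ 'n \<Rightarrow> real ^ 'n"
    and v :: "real ^ 'n"
    and z :: "nat \<Rightarrow> real ^ 'n"
  assumes "sym_pos_def M"
    and "nonexpansive_wrt (mat_norm M) T"
    and "infimal_displacement_vector (mat_norm M) T v"
    and "\<And>k. z (Suc k) = T (z k)"
  shows "(\<forall>\<epsilon>>0. \<exists>z\<epsilon>. \<forall>k\<ge>1.
            mat_norm M (v - (2 / (real k + 1)) *\<^sub>R (avg_iterate z k - z 0))
              \<le> 4 / (real k + 1) * mat_norm M (z 0 - z\<epsilon>) + \<epsilon>
          \<and> mat_norm M (v - (1 / real k) *\<^sub>R (z k - z 0))
              \<le> 2 / real k * mat_norm M (z 0 - z\<epsilon>) + \<epsilon>)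
       \<and> (closed (displacement_range T) \<longrightarrow>
            (\<exists>zs. T zs = zs + v)
          \<and> (\<forall>zs. T zs = zs + v \<longrightarrow> (\<forall>k\<ge>1.
                mat_norm M (v - (2 / (real k + 1)) *\<^sub>R (avg_iterate z k - z 0))
                  \<le> 4 / (real k + 1) * mat_norm M (z 0 - zs)
              \<and> mat_norm M (v - (1 / real k) *\<^sub>R (z k - z 0))
                  \<le> 2 / real k * mat_norm M (z 0 - zs))))"
proof -
  interpret infimal_displacement M T v
    using assms(1-3) by unfold_locales
  note bounds = normalized_average_bound[where z = z, OF assms(4)]
    normalized_iterate_bound[where z = z, OF assms(4)]
  show ?thesis
  proof (intro conjI allI impI)
    fix \<epsilon> :: real
    assume "0 < \<epsilon>"
    then obtain x where "(N (T x - x))\<^sup>2 \<le> (N v)\<^sup>2 + \<epsilon>\<^sup>2"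
      using exists_near_minimal_displacement by blast
    from bounds[OF this less_imp_le[OF \<open>0 < \<epsilon>\<close>]] show "\<exists>z\<epsilon>. \<forall>k\<ge>1.
        N (v - (2 / (real k + 1)) *\<^sub>R (avg_iterate z k - z 0)) \<le> 4 / (real k + 1) * N (z 0 - z\<epsilon>) + \<epsilon>
      \<and> N (v - (1 / real k) *\<^sub>R (z k - z 0)) \<le> 2 / real k * N (z 0 - z\<epsilon>) + \<epsilon>"
      by blast
  next
    assume "closed (displacement_range T)"
    then have "v \<in> displacement_range T"
      using v_in_closure by simp
    then show "\<exists>zs. T zs = zs + v"
      by (auto simp: displacement_range_def algebra_simps)
  next
    fix zs and k :: nat
    assume "T zs = zs + v" "1 \<le> k"
    then show "N (v - (2 / (real k + 1)) *\<^sub>R (avg_iterate z k - z 0))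
        \<le> 4 / (real k + 1) * N (z 0 - zs)"
      and "N (v - (1 / real k) *\<^sub>R (z k - z 0)) \<le> 2 / real k * N (z 0 - zs)"
      \<comment> \<open>With \<open>\<epsilon> = 0\<close> the hypothesis on the displacement holds
        with equality, since \<open>T zs - zs = v\<close>.\<close>
      using bounds[of zs 0 k] by simp_all
  qed
qed

end
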